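(* Let $\pi_e$ be an expert policy in a Markov decision process without reward signal $(S,A,T,\gamma,D)$, with discounted state distribution $\rho^{\pi_e}_s$ and discounted state-action joint distribution $\rho^{\pi_e}_{s,a}$. For a policy $\pi$ with discounted state distribution $\rho^{\pi}_s$, let the reward function be $$r_\pi(s,a)=\frac{\rho^{\pi_e}_s(s)}{\rho^{\pi}_s(s)}\,\pi_e(a\mid s)=\frac{\rho^{\pi_e}_{s,a}(s,a)}{\rho^{\pi}_s(s)},$$ and consider the performance objective $$J(\pi)=\int_S\rho^{\pi}_s(s)\int_A\pi(a\mid s)\,r_\pi(s,a)\,\mathrm{d}a\,\mathrm{d}s .$$ If the expert policy $\pi_e$ is deterministic (so that, for every policy $\pi$, $\langle\pi_e(a\mid s),\pi_e(a\mid s)\rangle\ge\langle\pi(a\mid s),\pi(a\mid s)\rangle$), then the optimal policy $\pi_*$, i.e. the policy maximizing $J(\pi)$ over all policies $\pi$, is identical to the expert policy: $\pi_*=\pi_e$.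
   Context: An MDP without reward signal is a tuple $(S,A,T,\gamma,D)$, where $S$ is the state space, $A$ is the action space (discrete or continuous), $T$ is the state transition probability model, $\gamma\in(0,1)$ is the discount factor, and $D$ is the initial state distribution from which $s_0$ is drawn. A policy $\pi$ assigns to each state $s$ a probability distribution $\pi(\cdot\mid s)$ on $A$ (a probability mass function if $A$ is discrete, a probability density if $A$ is continuous). The discounted state distribution of $\pi$ is $\rho^{\pi}_s(s)=\sum_{t=0}^{\infty}\gamma^t p(s_t=s\mid\pi)$, and the discounted state-action joint distribution is $\rho^{\pi}_{s,a}(s,a)=\rho^{\pi}_s(s)\,\pi(a\mid s)$. For discrete spaces the integrals are read as sums. The inner product is $\langle\pi(a\mid s),\pi(a\mid s)\rangle=\sum_{a}\pi^2(a\mid s)$ for discrete action spaces and $\int_a\pi^2(a\mid s)\,\mathrm{d}a$ for continuous action spaces. A deterministic policy selects, in each state, a single action with probability $1$; in a continuous action space its density is a shifted Dirac function $\delta(a-a_0)$, where $a_0$ depends on $s$, and the inner product of such a policy with itself is regarded as $+\infty$.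
   Formalization: Equality with the expert policy is claimed only at almost every state with positive expert discounted state density; for continuous action spaces, where J of the expert is infinite and maximizers are not unique, the optimal policy must maximize the part of J over every measurable set of states. *)

theory Defs
  imports "HOL-Probability.Probability"
begin

text \<open>
  Functions and distributions on a state or action space are densities with respect to a reference
  measure: counting measure on a discrete space, so that integrals are sums and densities are
  probability mass functions, and an atomless sigma-finite measure such as Lebesgue measure on
  a Borel subset of a Euclidean space in the continuous case.
\<close>

definition discrete_space :: "'x measure \<Rightarrow> bool" where
  "discrete_space N \<longleftrightarrow> (\<exists>X. countable X \<and> N = count_space X)"

definition continuous_space :: "'x measure \<Rightarrow> bool" where
  "continuous_space N \<longleftrightarrow> sigma_finite_measure N \<and> (\<forall>x\<in>space N. {x} \<in> null_sets N)"

lemma continuous_space_lborel: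
  fixes X :: "'x::euclidean_space set"
  assumes "X \<in> sets borel"
  shows "continuous_space (restrict_space lborel X)"
proof -
  have "sigma_finite_measure (restrict_space (lborel :: 'x measure) X)"
    using assms by (intro sigma_finite_measure_restrict_space sigma_finite_lborel) simp
  then show ?thesis
    using assms unfolding continuous_space_def
    by (auto simp: null_sets_restrict_space space_restrict_space)
qed


text \<open>
  Nonnegative generalized functions on the action space: ordinary functions and multiples
  \<open>c \<cdot> \<delta>(a - a\<^sub>0)\<close> of shifted Dirac functions, the latter written \<open>Dirac c a\<^sub>0\<close>.
\<close>

datatype 'a gfun = Fun "'a \<Rightarrow> ennreal" | Dirac ennreal 'a

text \<open>The pointwise value, with the usual reading that \<open>\<delta>\<close> is infinite at \<open>0\<close> and zero elsewhere.\<close>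

fun gfun_value :: "'a gfun \<Rightarrow> 'a \<Rightarrow> ennreal" where
  "gfun_value (Fun f) a = f a"
| "gfun_value (Dirac c b) a = c * (if a = b then \<infinity> else 0)"

fun gfun_scale :: "ennreal \<Rightarrow> 'a gfun \<Rightarrow> 'a gfun" where
  "gfun_scale c (Fun f) = Fun (\<lambda>a. c * f a)"
| "gfun_scale c (Dirac d b) = Dirac (c * d) b"

fun gfun_measure :: "'a measure \<Rightarrow> 'a gfun \<Rightarrow> 'a measure" where
  "gfun_measure N (Fun f) = density N f"
| "gfun_measure N (Dirac c b) = scale_measure c (return N b)"

text \<open>
  The integral of a product \<open>\<integral> f(a) g(a) da\<close>.  A Dirac factor evaluates the other one by the sifting
  property; in particular a Dirac function has infinite inner product with itself.
\<close>

fun gfun_inner :: "'a measure \<Rightarrow> 'a gfun \<Rightarrow> 'a gfun \<Rightarrow> ennreal" where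
  "gfun_inner N (Fun f) (Fun g) = (\<integral>\<^sup>+ a. f a * g a \<partial>N)"
| "gfun_inner N (Fun f) (Dirac d b) = d * f b"
| "gfun_inner N (Dirac c b) g = c * gfun_value g b"


record ('s, 'a) mdp =
  states :: "'s measure"
  actions :: "'a measure"
  trans :: "'s \<Rightarrow> 'a \<Rightarrow> 's \<Rightarrow> ennreal"
  disc :: real
  init :: "'s \<Rightarrow> ennreal"

definition is_mdp :: "('s, 'a) mdp \<Rightarrow> bool" where
  "is_mdp M \<longleftrightarrow>
     (discrete_space (states M) \<or> continuous_space (states M)) \<and>
     (discrete_space (actions M) \<or> continuous_space (actions M)) \<and>
     (\<lambda>(s, a, s'). trans M s a s')
       \<in> borel_measurable (states M \<Otimes>\<^sub>M actions M \<Otimes>\<^sub>M states M) \<and>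
     (\<forall>s\<in>space (states M). \<forall>a\<in>space (actions M). (\<integral>\<^sup>+ s'. trans M s a s' \<partial>states M) = 1) \<and>
     0 < disc M \<and> disc M < 1 \<and>
     init M \<in> borel_measurable (states M) \<and> (\<integral>\<^sup>+ s. init M s \<partial>states M) = 1"

text \<open>
  Action distributions are finite-valued densities of total mass one, or Dirac functions.  The latter
  are needed only at points of reference measure zero, hence never in a discrete space, where
  a point mass is itself a probability mass function.
\<close>

fun action_dist :: "'a measure \<Rightarrow> 'a gfun \<Rightarrow> bool" where
  "action_dist N (Fun f) \<longleftrightarrow>
     f \<in> borel_measurable N \<and> (\<forall>a\<in>space N. f a < \<infinity>) \<and> (\<integral>\<^sup>+ a. f a \<partial>N) = 1"
| "action_dist N (Dirac c b) \<longleftrightarrow> c = 1 \<and> b \<in> space N \<and> {b} \<in> null_sets N"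

definition policy :: "('s, 'a) mdp \<Rightarrow> ('s \<Rightarrow> 'a gfun) \<Rightarrow> bool" where
  "policy M \<pi> \<longleftrightarrow>
     (\<forall>s\<in>space (states M). action_dist (actions M) (\<pi> s)) \<and>
     (\<lambda>(s, a). gfun_value (\<pi> s) a) \<in> borel_measurable (states M \<Otimes>\<^sub>M actions M) \<and>
     (\<lambda>s. gfun_measure (actions M) (\<pi> s)) \<in> states M \<rightarrow>\<^sub>M prob_algebra (actions M)"

definition deterministic :: "('s, 'a) mdp \<Rightarrow> ('s \<Rightarrow> 'a gfun) \<Rightarrow> bool" where
  "deterministic M \<pi> \<longleftrightarrow>
     (\<forall>s\<in>space (states M). \<exists>a\<in>space (actions M).
        emeasure (gfun_measure (actions M) (\<pi> s)) {a} = 1)"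

text \<open>\<open>state_dist M \<pi> t s\<close> is \<open>p(s\<^sub>t = s | \<pi>)\<close>.\<close>

primrec state_dist :: "('s, 'a) mdp \<Rightarrow> ('s \<Rightarrow> 'a gfun) \<Rightarrow> nat \<Rightarrow> 's \<Rightarrow> ennreal" where
  "state_dist M \<pi> 0 = init M"
| "state_dist M \<pi> (Suc t) =
     (\<lambda>s'. \<integral>\<^sup>+ s. state_dist M \<pi> t s *
        (\<integral>\<^sup>+ a. trans M s a s' \<partial>gfun_measure (actions M) (\<pi> s)) \<partial>states M)"

definition disc_state_dist :: "('s, 'a) mdp \<Rightarrow> ('s \<Rightarrow> 'a gfun) \<Rightarrow> 's \<Rightarrow> ennreal" where
  "disc_state_dist M \<pi> s = (\<Sum>t. ennreal (disc M ^ t) * state_dist M \<pi> t s)"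

definition disc_joint_dist :: "('s, 'a) mdp \<Rightarrow> ('s \<Rightarrow> 'a gfun) \<Rightarrow> 's \<Rightarrow> 'a gfun" where
  "disc_joint_dist M \<pi> s = gfun_scale (disc_state_dist M \<pi> s) (\<pi> s)"

text \<open>
  Division by \<open>disc_state_dist M \<pi> s = 0\<close> is harmless: the reward is weighted by that same number
  in the objective, and \<open>0 * \<infinity> = 0\<close> in the extended nonnegative reals.
\<close>

definition reward :: "('s, 'a) mdp \<Rightarrow> ('s \<Rightarrow> 'a gfun) \<Rightarrow> ('s \<Rightarrow> 'a gfun) \<Rightarrow> 's \<Rightarrow> 'a gfun" where
  "reward M \<pi>\<^sub>e \<pi> s = gfun_scale (disc_state_dist M \<pi>\<^sub>e s / disc_state_dist M \<pi> s) (\<pi>\<^sub>e s)"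

lemma reward_eq_joint:
  "reward M \<pi>\<^sub>e \<pi> s = gfun_scale (1 / disc_state_dist M \<pi> s) (disc_joint_dist M \<pi>\<^sub>e s)"
  unfolding reward_def disc_joint_dist_def
  by (cases "\<pi>\<^sub>e s") (auto simp: divide_ennreal_def mult_ac)

text \<open>The contribution to the objective of the states in \<open>B\<close>.\<close>

definition objective_on ::
    "('s, 'a) mdp \<Rightarrow> ('s \<Rightarrow> 'a gfun) \<Rightarrow> 's set \<Rightarrow> ('s \<Rightarrow> 'a gfun) \<Rightarrow> ennreal" where
  "objective_on M \<pi>\<^sub>e B \<pi> =
     (\<integral>\<^sup>+ s\<in>B. disc_state_dist M \<pi> s *
        gfun_inner (actions M) (\<pi> s) (reward M \<pi>\<^sub>e \<pi> s) \<partial>states M)"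

definition objective :: "('s, 'a) mdp \<Rightarrow> ('s \<Rightarrow> 'a gfun) \<Rightarrow> ('s \<Rightarrow> 'a gfun) \<Rightarrow> ennreal" where
  "objective M \<pi>\<^sub>e \<pi> =
     (\<integral>\<^sup>+ s. disc_state_dist M \<pi> s *
        gfun_inner (actions M) (\<pi> s) (reward M \<pi>\<^sub>e \<pi> s) \<partial>states M)"

definition optimal :: "('s, 'a) mdp \<Rightarrow> ('s \<Rightarrow> 'a gfun) \<Rightarrow> ('s \<Rightarrow> 'a gfun) \<Rightarrow> bool" where
  "optimal M \<pi>\<^sub>e \<pi> \<longleftrightarrow>
     policy M \<pi> \<and> (\<forall>\<pi>'. policy M \<pi>' \<longrightarrow> objective M \<pi>\<^sub>e \<pi>' \<le> objective M \<pi>\<^sub>e \<pi>)"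

text \<open>
  In a continuous action space the objective of a deterministic expert is infinite, and so is that
  of every policy that agrees with the expert on some set of states to which both discounted state
  distributions give positive weight: comparing the totals alone cannot single out one policy.  Comparing the objective on all measurable sets
  of states does.  Where the optimal value is finite, this is the same as optimality.
\<close>

definition locally_optimal :: "('s, 'a) mdp \<Rightarrow> ('s \<Rightarrow> 'a gfun) \<Rightarrow> ('s \<Rightarrow> 'a gfun) \<Rightarrow> bool" where
  "locally_optimal M \<pi>\<^sub>e \<pi> \<longleftrightarrow>
     policy M \<pi> \<and>
     (\<forall>B\<in>sets (states M). \<forall>\<pi>'. policy M \<pi>' \<longrightarrow>
        objective_on M \<pi>\<^sub>e B \<pi>' \<le> objective_on M \<pi>\<^sub>e B \<pi>)"

text \<open>
  Policies are identified if they choose the same action distribution in almost every state that the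
  expert visits (every such state, for a discrete state space).  A policy with this property attains
  the same objective as the expert, whatever it does elsewhere.
\<close>

definition same_policy :: "('s, 'a) mdp \<Rightarrow> ('s \<Rightarrow> 'a gfun) \<Rightarrow> ('s \<Rightarrow> 'a gfun) \<Rightarrow> bool" where
  "same_policy M \<pi>\<^sub>e \<pi> \<longleftrightarrow>
     (AE s in states M. disc_state_dist M \<pi>\<^sub>e s > 0 \<longrightarrow>
        gfun_measure (actions M) (\<pi> s) = gfun_measure (actions M) (\<pi>\<^sub>e s))"

end

theory Submission imports Defs
begin

text \<open>
  The factor \<open>\<rho>\<^sup>\<pi>\<close> cancels against the denominator of the reward, so the objective of \<open>\<pi>\<close> is at most
  the integral of \<open>\<rho>\<^sup>e(s) \<langle>\<pi>(s), \<pi>\<^sub>e(s)\<rangle>\<close>, with equality for \<open>\<pi> = \<pi>\<^sub>e\<close> because \<open>\<rho>\<^sup>e\<close> has finite total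
  mass \<open>1 / (1 - \<gamma>)\<close> and is therefore finite almost everywhere.  If \<open>\<pi>\<^sub>e(s)\<close> is concentrated at a
  point \<open>a\<close>, the inner product is the value of \<open>\<pi>(s)\<close> at \<open>a\<close>, which is maximal exactly for
  \<open>\<pi>(s) = \<pi>\<^sub>e(s)\<close>.  The maximum is \<open>1\<close> in a discrete action space, and the integrals can be compared
  because they are finite.  In a continuous one it is \<open>\<infinity>\<close>; here one compares the objectives on the
  sets of states where the inner product is at most \<open>n\<close>, on which the one of \<open>\<pi>\<close> is finite.
\<close>

section \<open>Discounted state distributions\<close>

lemma sigma_finite_space:
  "discrete_space N \<or> continuous_space N \<Longrightarrow> sigma_finite_measure N"
  by (auto simp: discrete_space_def continuous_space_def
           intro: sigma_finite_measure_count_space_countable)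

section \<open>One-step transition kernel induced by a policy\<close>

lemma measurable_gfun_measure:
  assumes "policy M \<pi>"
  shows "(\<lambda>s. gfun_measure (actions M) (\<pi> s)) \<in> states M \<rightarrow>\<^sub>M subprob_algebra (actions M)"
  using assms by (simp add: policy_def measurable_prob_algebraD)

lemma measurable_policy_transition:
  assumes "is_mdp M" "policy M \<pi>"
  shows "(\<lambda>(s, s'). \<integral>\<^sup>+ a. trans M s a s' \<partial>gfun_measure (actions M) (\<pi> s))
    \<in> borel_measurable (states M \<Otimes>\<^sub>M states M)"
proof -
  have t: "(\<lambda>(s, a, s'). trans M s a s')
       \<in> borel_measurable (states M \<Otimes>\<^sub>M actions M \<Otimes>\<^sub>M states M)"
    using assms(1) by (simp add: is_mdp_def)
  \<comment> \<open>The variables are reordered so that the action comes last, where the policy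
    kernel integrates it out.\<close>
  have "(\<lambda>p. (fst (fst p), snd p, snd (fst p)))
      \<in> (states M \<Otimes>\<^sub>M states M) \<Otimes>\<^sub>M actions M \<rightarrow>\<^sub>M states M \<Otimes>\<^sub>M actions M \<Otimes>\<^sub>M states M"
    by measurable
  from measurable_compose[OF this t]
  have 1: "(\<lambda>(p, a). trans M (fst p) a (snd p))
      \<in> borel_measurable ((states M \<Otimes>\<^sub>M states M) \<Otimes>\<^sub>M actions M)"
    by (simp add: case_prod_beta')
  have 2: "(\<lambda>p. gfun_measure (actions M) (\<pi> (fst p)))
      \<in> states M \<Otimes>\<^sub>M states M \<rightarrow>\<^sub>M subprob_algebra (actions M)"
    by (rule measurable_compose[OF measurable_fst measurable_gfun_measure[OF assms(2)]])
  show ?thesis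
    using nn_integral_measurable_subprob_algebra2[OF 1 2] by (simp add: case_prod_beta')
qed

text \<open>Exchanging the integrals leaves the mass of a transition density, which is 1 for every
  action, averaged over a probability measure.\<close>

lemma nn_integral_policy_transition:
  assumes "is_mdp M" "policy M \<pi>" "s \<in> space (states M)"
  shows "(\<integral>\<^sup>+ s'. (\<integral>\<^sup>+ a. trans M s a s' \<partial>gfun_measure (actions M) (\<pi> s)) \<partial>states M) = 1"
proof -
  let ?\<mu> = "gfun_measure (actions M) (\<pi> s)"
  have "?\<mu> \<in> space (prob_algebra (actions M))"
    using assms by (auto simp: policy_def dest: measurable_space)
  then have prob: "prob_space ?\<mu>" and sets [measurable_cong]: "sets ?\<mu> = sets (actions M)"
    by (auto simp: space_prob_algebra)
  interpret \<mu>: prob_space ?\<mu> by (fact prob)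
  interpret S: sigma_finite_measure "states M"
    using assms(1) by (auto simp: is_mdp_def intro: sigma_finite_space)
  interpret P: pair_sigma_finite ?\<mu> "states M" ..
  have t [measurable]: "(\<lambda>(s, a, s'). trans M s a s')
       \<in> borel_measurable (states M \<Otimes>\<^sub>M actions M \<Otimes>\<^sub>M states M)"
    using assms(1) by (simp add: is_mdp_def)
  have "(\<lambda>(a, s'). trans M s a s') \<in> borel_measurable (?\<mu> \<Otimes>\<^sub>M states M)"
    using assms(3) by measurable
  then have "(\<integral>\<^sup>+ s'. (\<integral>\<^sup>+ a. trans M s a s' \<partial>?\<mu>) \<partial>states M)
      = (\<integral>\<^sup>+ a. (\<integral>\<^sup>+ s'. trans M s a s' \<partial>states M) \<partial>?\<mu>)"
    by (rule P.Fubini')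
  also have "\<dots> = (\<integral>\<^sup>+ a. 1 \<partial>?\<mu>)"
    using assms(1,3) sets_eq_imp_space_eq[OF sets] by (intro nn_integral_cong) (auto simp: is_mdp_def)
  also have "\<dots> = 1"
    by (simp add: \<mu>.emeasure_space_1)
  finally show ?thesis .
qed

section \<open>State distributions at each time and their discounted sum\<close>

lemma measurable_state_dist:
  assumes "is_mdp M" "policy M \<pi>"
  shows "state_dist M \<pi> t \<in> borel_measurable (states M)"
proof (induction t)
  case 0
  then show ?case using assms(1) by (simp add: is_mdp_def)
next
  case (Suc t)
  interpret S: sigma_finite_measure "states M"
    using assms(1) by (auto simp: is_mdp_def intro: sigma_finite_space)
  note [measurable] = Suc measurable_policy_transition[OF assms]
  show ?case by simp
qed

text \<open>Mass is preserved in each step: after exchanging the integrals, the inner one is the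
  mass 1 of the one-step kernel.\<close>

lemma nn_integral_state_dist:
  assumes "is_mdp M" "policy M \<pi>"
  shows "(\<integral>\<^sup>+ s. state_dist M \<pi> t s \<partial>states M) = 1"
proof (induction t)
  case 0
  then show ?case using assms(1) by (simp add: is_mdp_def)
next
  case (Suc t)
  interpret S: sigma_finite_measure "states M"
    using assms(1) by (auto simp: is_mdp_def intro: sigma_finite_space)
  interpret P: pair_sigma_finite "states M" "states M" ..
  note [measurable] = measurable_state_dist[OF assms] measurable_policy_transition[OF assms]
  let ?K = "\<lambda>s s'. \<integral>\<^sup>+ a. trans M s a s' \<partial>gfun_measure (actions M) (\<pi> s)"
  have "(\<integral>\<^sup>+ s'. state_dist M \<pi> (Suc t) s' \<partial>states M)
      = (\<integral>\<^sup>+ s. (\<integral>\<^sup>+ s'. state_dist M \<pi> t s * ?K s s' \<partial>states M) \<partial>states M)"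
    unfolding state_dist.simps by (rule P.Fubini') measurable
  also have "\<dots> = (\<integral>\<^sup>+ s. state_dist M \<pi> t s * (\<integral>\<^sup>+ s'. ?K s s' \<partial>states M) \<partial>states M)"
    by (intro nn_integral_cong nn_integral_cmult) measurable
  also have "\<dots> = (\<integral>\<^sup>+ s. state_dist M \<pi> t s \<partial>states M)"
    by (intro nn_integral_cong) (simp add: nn_integral_policy_transition[OF assms])
  finally show ?case using Suc by simp
qed

lemma measurable_disc_state_dist:
  assumes "is_mdp M" "policy M \<pi>"
  shows "disc_state_dist M \<pi> \<in> borel_measurable (states M)"
  unfolding disc_state_dist_def[abs_def] using measurable_state_dist[OF assms] by measurable

lemma nn_integral_disc_state_dist:
  assumes "is_mdp M" "policy M \<pi>"
  shows "(\<integral>\<^sup>+ s. disc_state_dist M \<pi> s \<partial>states M) = ennreal (1 / (1 - disc M))"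
proof -
  note [measurable] = measurable_state_dist[OF assms]
  have d: "0 < disc M" "disc M < 1"
    using assms(1) by (auto simp: is_mdp_def)
  have "(\<integral>\<^sup>+ s. disc_state_dist M \<pi> s \<partial>states M) = (\<Sum>t. ennreal (disc M ^ t))"
    unfolding disc_state_dist_def
    by (subst nn_integral_suminf) (simp_all add: nn_integral_cmult nn_integral_state_dist[OF assms])
  also have "\<dots> = ennreal (\<Sum>t. disc M ^ t)"
    using d by (intro suminf_ennreal2) (auto intro: summable_geometric)
  finally show ?thesis
    using d by (simp add: suminf_geometric)
qed

lemma AE_disc_state_dist_finite:
  assumes "is_mdp M" "policy M \<pi>"
  shows "AE s in states M. disc_state_dist M \<pi> s < \<infinity>"
  using nn_integral_PInf_AE[OF measurable_disc_state_dist[OF assms]]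
  by (simp add: nn_integral_disc_state_dist[OF assms] less_top)

section \<open>Inner products of action distributions\<close>

text \<open>Extracts the state-dependent factor from the reward. Being action distributions,
  \<open>f\<close> and \<open>g\<close> are measurable when they are ordinary functions, so a
  constant can leave the integral.\<close>

lemma gfun_inner_scale:
  assumes "action_dist N f" "action_dist N g"
  shows "gfun_inner N f (gfun_scale c g) = c * gfun_inner N f g"
  using assms by (cases f; cases g) (auto simp: nn_integral_cmult[symmetric] mult_ac)

text \<open>Covers point masses in discrete spaces and Dirac functions in continuous ones uniformly,
  with the location explicit so that it can be chosen per state.\<close>

definition concentrated :: "'a measure \<Rightarrow> 'a \<Rightarrow> 'a gfun \<Rightarrow> bool" where
  "concentrated N a g \<longleftrightarrow> a \<in> space N \<and> emeasure (gfun_measure N g) {a} = 1"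

text \<open>Under counting measure a singleton has mass 1 and is not a null set, which excludes the
  Dirac constructor.\<close>

lemma discrete_action_dist_cases:
  assumes "discrete_space N" "action_dist N g"
  obtains f where "g = Fun f" "(\<integral>\<^sup>+ a. f a \<partial>N) = 1"
  using assms by (cases g) (auto simp: discrete_space_def null_sets_def)

lemma discrete_action_dist_le_1:
  assumes "discrete_space N" "(\<integral>\<^sup>+ a. f a \<partial>N) = 1" "a \<in> space N"
  shows "f a \<le> 1"
proof -
  obtain X where N: "N = count_space X" using assms(1) by (auto simp: discrete_space_def)
  show ?thesis
    using nn_integral_ge_point[of a X f] assms by (simp add: N)
qed

text \<open>Any further atom would push the total mass above 1, as the pair \<open>{a, b}\<close>
  alone has mass \<open>1 + f b\<close>.\<close>

lemma discrete_concentrated: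
  assumes N: "discrete_space N" and f: "(\<integral>\<^sup>+ a. f a \<partial>N) = 1" and a: "a \<in> space N" "f a = 1"
    and b: "b \<in> space N"
  shows "f b = indicator {a} b"
proof (cases "a = b")
  case False
  obtain X where X: "N = count_space X" using N by (auto simp: discrete_space_def)
  have "1 + f b = (\<integral>\<^sup>+ x. f x * indicator {a, b} x \<partial>N)"
    using a b False by (subst nn_integral_indicator_finite) (auto simp: X)
  also have "\<dots> \<le> 1"
    unfolding f[symmetric] by (intro nn_integral_mono) (auto split: split_indicator)
  \<comment> \<open>A sum on both sides allows the finite summand 1 to be cancelled in
    \<open>ennreal\<close>.\<close>
  finally have "1 + f b \<le> 1 + 0" by simp
  then show ?thesis
    using False by (subst (asm) ennreal_add_left_cancel_le) auto
qed (use a in auto)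

lemma discrete_concentrated_cases:
  assumes "discrete_space N" "action_dist N g" "concentrated N a g"
  obtains h where "g = Fun h" "\<And>b. b \<in> space N \<Longrightarrow> h b = indicator {a} b"
proof -
  obtain h where h: "g = Fun h" "(\<integral>\<^sup>+ a. h a \<partial>N) = 1"
    using discrete_action_dist_cases[OF assms(1,2)] .
  obtain X where N: "N = count_space X" using assms(1) by (auto simp: discrete_space_def)
  have a: "a \<in> space N" and "emeasure (density N h) {a} = 1"
    using assms(3) h by (auto simp: concentrated_def)
  then have "h a = 1"
    by (simp add: N emeasure_density nn_integral_indicator_finite)
  with that h a show ?thesis
    using discrete_concentrated[OF assms(1) h(2) a] by blast
qed

text \<open>A density gives no mass to a null singleton, so only a Dirac function can be
  concentrated at \<open>a\<close>, and its location must be \<open>a\<close>.\<close>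

lemma continuous_concentrated_cases:
  assumes N: "continuous_space N" and g: "action_dist N g" "concentrated N a g"
  shows "g = Dirac 1 a"
proof (cases g)
  case (Fun h)
  have null: "{a} \<in> null_sets N"
    using N g(2) by (auto simp: continuous_space_def concentrated_def)
  have "emeasure (density N h) {a} = 0"
    using null g(1) by (subst emeasure_density) (auto simp: Fun nn_integral_null_set)
  then show ?thesis
    using g(2) by (simp add: Fun concentrated_def)
next
  case (Dirac c b)
  then have "c = 1" "b \<in> space N" "{b} \<in> null_sets N"
    using g by auto
  \<comment> \<open>Measurability of \<open>{a}\<close> makes its mass under the point measure at
    \<open>b\<close> the indicator of \<open>a = b\<close>.\<close>
  moreover have "{a} \<in> sets N"
    using N g(2) by (auto simp: continuous_space_def concentrated_def)
  ultimately show ?thesis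
    using g(2) by (auto simp: Dirac concentrated_def indicator_def split: if_splits)
qed

text \<open>A sum against an indicator keeps one term, and a Dirac function sifts out one value. For
  two Dirac functions the formula is symmetric in the locations.\<close>

lemma gfun_inner_concentrated:
  assumes "discrete_space N \<or> continuous_space N" "action_dist N f" "action_dist N g"
    and "concentrated N a g"
  shows "gfun_inner N f g = gfun_value f a"
  using assms(1)
proof
  assume N: "discrete_space N"
  obtain h where h: "g = Fun h" "\<And>b. b \<in> space N \<Longrightarrow> h b = indicator {a} b"
    using discrete_concentrated_cases[OF N assms(3,4)] by blast
  obtain f' where f': "f = Fun f'"
    using discrete_action_dist_cases[OF N assms(2)] .
  obtain X where X: "N = count_space X" using N by (auto simp: discrete_space_def)
  have a: "a \<in> space N" using assms(4) by (simp add: concentrated_def)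
  have "gfun_inner N f g = (\<integral>\<^sup>+ x. f' x * indicator {a} x \<partial>N)"
    using h by (auto simp: f' intro!: nn_integral_cong)
  also have "\<dots> = f' a"
    using a by (simp add: X nn_integral_indicator_finite)
  finally show ?thesis by (simp add: f')
next
  assume "continuous_space N"
  from continuous_concentrated_cases[OF this assms(3,4)] show ?thesis
    using assms(2) by (cases f) auto
qed

section \<open>Maximality of inner products with a concentrated distribution\<close>

lemma gfun_inner_self_concentrated:
  assumes "action_dist N g" "concentrated N a g"
  shows "discrete_space N \<Longrightarrow> gfun_inner N g g = 1"
    and "continuous_space N \<Longrightarrow> gfun_inner N g g = \<infinity>"
proof -
  have a: "a \<in> space N" using assms(2) by (simp add: concentrated_def)
  show "gfun_inner N g g = 1" if N: "discrete_space N"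
    using discrete_concentrated_cases[OF N assms] gfun_inner_concentrated[OF _ assms(1) assms] N a
    by (metis gfun_value.simps(1) indicator_simps(1) singletonI)
  show "gfun_inner N g g = \<infinity>" if "continuous_space N"
    using continuous_concentrated_cases[OF that assms] by simp
qed

lemma gfun_inner_le_concentrated:
  assumes N: "discrete_space N \<or> continuous_space N" and f: "action_dist N f"
    and g: "action_dist N g" "concentrated N a g"
  shows "gfun_inner N f g \<le> gfun_inner N g g"
  using N
proof
  assume D: "discrete_space N"
  obtain f' where "f = Fun f'" "(\<integral>\<^sup>+ a. f' a \<partial>N) = 1"
    using discrete_action_dist_cases[OF D f] .
  then show ?thesis
    using gfun_inner_concentrated[OF N f g] gfun_inner_self_concentrated(1)[OF g D]
      discrete_action_dist_le_1[OF D] g(2) by (auto simp: concentrated_def)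
qed (simp add: gfun_inner_self_concentrated(2)[OF g])

text \<open>Probabilities are at most 1, so their squares are dominated by a function of sum 1; in a
  continuous space the bound is infinite.\<close>

lemma gfun_inner_self_le_concentrated:
  assumes N: "discrete_space N \<or> continuous_space N" and f: "action_dist N f"
    and g: "action_dist N g" "concentrated N a g"
  shows "gfun_inner N f f \<le> gfun_inner N g g"
  using N
proof
  assume D: "discrete_space N"
  obtain f' where f': "f = Fun f'" "(\<integral>\<^sup>+ a. f' a \<partial>N) = 1"
    using discrete_action_dist_cases[OF D f] .
  have "(\<integral>\<^sup>+ a. f' a * f' a \<partial>N) \<le> (\<integral>\<^sup>+ a. f' a * 1 \<partial>N)"
    using discrete_action_dist_le_1[OF D f'(2)] by (intro nn_integral_mono mult_left_mono) auto
  then show ?thesis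
    using f' gfun_inner_self_concentrated(1)[OF g D] by simp
qed (simp add: gfun_inner_self_concentrated(2)[OF g])

text \<open>The equality case of the bound, from which uniqueness follows: the value of
  \<open>f\<close> at \<open>a\<close> attains its maximum, 1 or \<infinity>.\<close>

lemma gfun_measure_eq_of_inner_eq:
  assumes N: "discrete_space N \<or> continuous_space N" and f: "action_dist N f"
    and g: "action_dist N g" "concentrated N a g"
    and eq: "gfun_inner N f g = gfun_inner N g g"
  shows "gfun_measure N f = gfun_measure N g"
  using N
proof
  assume D: "discrete_space N"
  obtain f' where f': "f = Fun f'" "(\<integral>\<^sup>+ a. f' a \<partial>N) = 1"
    using discrete_action_dist_cases[OF D f] .
  obtain h where h: "g = Fun h" "\<And>b. b \<in> space N \<Longrightarrow> h b = indicator {a} b"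
    using discrete_concentrated_cases[OF D g] by blast
  have a: "a \<in> space N" using g(2) by (simp add: concentrated_def)
  have "f' a = 1"
    using gfun_inner_concentrated[OF N f g] gfun_inner_self_concentrated(1)[OF g D] eq
    by (simp add: f')
  then have "AE b in N. f' b = h b"
    using discrete_concentrated[OF D f'(2) a] h(2) by (intro AE_I2) auto
  then show ?thesis
    using f g by (auto simp: f' h intro!: density_cong)
next
  assume C: "continuous_space N"
  have "gfun_value f a = \<infinity>"
    using gfun_inner_concentrated[OF N f g] gfun_inner_self_concentrated(2)[OF g C] eq by simp
  \<comment> \<open>Densities in \<open>action_dist\<close> are finite-valued, so an infinite value
    at \<open>a\<close> forces a Dirac function located there.\<close>
  then have "f = Dirac 1 a"
    using f g(2) by (cases f) (auto simp: concentrated_def split: if_splits)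
  then show ?thesis
    using continuous_concentrated_cases[OF C g] by simp
qed

section \<open>Comparison of objectives\<close>

lemma policy_action_dist:
  "policy M \<pi> \<Longrightarrow> s \<in> space (states M) \<Longrightarrow> action_dist (actions M) (\<pi> s)"
  by (simp add: policy_def)

text \<open>A pointwise choice of the selected action, with no claim of measurability in the
  state.\<close>

lemma deterministic_concentrated:
  assumes "deterministic M \<pi>"
  obtains b where "\<And>s. s \<in> space (states M) \<Longrightarrow> concentrated (actions M) (b s) (\<pi> s)"
  using assms unfolding deterministic_def concentrated_def by metis

lemma mdp_actions:
  "is_mdp M \<Longrightarrow> discrete_space (actions M) \<or> continuous_space (actions M)"
  by (simp add: is_mdp_def)

text \<open>Only an inequality: for \<open>x = 0\<close> and \<open>x = \<infinity>\<close> the left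
  side is 0, whatever \<open>y\<close> is.\<close>

lemma ennreal_mult_divide_le: "x * (y / x) \<le> (y :: ennreal)"
proof (cases "x = 0 \<or> x = \<infinity>")
  case False
  then show ?thesis
    by (simp add: ennreal_times_divide mult.commute[of x] ennreal_mult_divide_eq)
qed auto

lemma objective_integrand_le:
  assumes "policy M \<pi>\<^sub>e" "policy M \<pi>" "s \<in> space (states M)"
  shows "disc_state_dist M \<pi> s * gfun_inner (actions M) (\<pi> s) (reward M \<pi>\<^sub>e \<pi> s)
    \<le> disc_state_dist M \<pi>\<^sub>e s * gfun_inner (actions M) (\<pi> s) (\<pi>\<^sub>e s)"
  using mult_right_mono[OF ennreal_mult_divide_le[of "disc_state_dist M \<pi> s"],
      of "gfun_inner (actions M) (\<pi> s) (\<pi>\<^sub>e s)" "disc_state_dist M \<pi>\<^sub>e s"]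
  by (simp add: reward_def gfun_inner_scale policy_action_dist[OF assms(1,3)]
      policy_action_dist[OF assms(2,3)] mult.assoc)

text \<open>For a positive finite weight the quotient in the reward is 1, and for weight 0 both
  sides vanish. Finiteness is assumed because \<open>\<infinity> / \<infinity> = 0\<close> in
  \<open>ennreal\<close>.\<close>

lemma objective_integrand_self:
  assumes "policy M \<pi>" "s \<in> space (states M)" "disc_state_dist M \<pi> s < \<infinity>"
  shows "disc_state_dist M \<pi> s * gfun_inner (actions M) (\<pi> s) (reward M \<pi> \<pi> s)
    = disc_state_dist M \<pi> s * gfun_inner (actions M) (\<pi> s) (\<pi> s)"
proof (cases "disc_state_dist M \<pi> s = 0")
  case False
  then show ?thesis
    using assms(3)
    by (simp add: reward_def gfun_inner_scale policy_action_dist[OF assms(1,2)])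
qed simp

section \<open>Bounds on the objective over a set of states\<close>

lemma objective_eq_objective_on: "objective M \<pi>\<^sub>e \<pi> = objective_on M \<pi>\<^sub>e (space (states M)) \<pi>"
  unfolding objective_def objective_on_def by (intro nn_integral_cong) simp

lemma objective_on_le:
  assumes "policy M \<pi>\<^sub>e" "policy M \<pi>"
  shows "objective_on M \<pi>\<^sub>e B \<pi> \<le>
    (\<integral>\<^sup>+ s\<in>B. disc_state_dist M \<pi>\<^sub>e s * gfun_inner (actions M) (\<pi> s) (\<pi>\<^sub>e s) \<partial>states M)"
  unfolding objective_on_def
  by (intro nn_integral_mono mult_right_mono objective_integrand_le assms) auto

lemma objective_on_self:
  assumes "is_mdp M" "policy M \<pi>\<^sub>e"
  shows "objective_on M \<pi>\<^sub>e B \<pi>\<^sub>e =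
    (\<integral>\<^sup>+ s\<in>B. disc_state_dist M \<pi>\<^sub>e s * gfun_inner (actions M) (\<pi>\<^sub>e s) (\<pi>\<^sub>e s) \<partial>states M)"
  unfolding objective_on_def
proof (rule nn_integral_cong_AE)
  show "AE s in states M.
    disc_state_dist M \<pi>\<^sub>e s * gfun_inner (actions M) (\<pi>\<^sub>e s) (reward M \<pi>\<^sub>e \<pi>\<^sub>e s) * indicator B s =
    disc_state_dist M \<pi>\<^sub>e s * gfun_inner (actions M) (\<pi>\<^sub>e s) (\<pi>\<^sub>e s) * indicator B s"
    using AE_disc_state_dist_finite[OF assms] AE_space
    by eventually_elim (simp add: objective_integrand_self[OF assms(2)])
qed

text \<open>The pointwise maximality of the inner product is integrated over \<open>B\<close>;
  arbitrary \<open>B\<close> serves both notions of optimality.\<close>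

lemma objective_on_expert_max:
  assumes "is_mdp M" "policy M \<pi>\<^sub>e" "deterministic M \<pi>\<^sub>e" "policy M \<pi>"
  shows "objective_on M \<pi>\<^sub>e B \<pi> \<le> objective_on M \<pi>\<^sub>e B \<pi>\<^sub>e"
proof -
  obtain b where b: "\<And>s. s \<in> space (states M) \<Longrightarrow> concentrated (actions M) (b s) (\<pi>\<^sub>e s)"
    using deterministic_concentrated[OF assms(3)] by blast
  have "objective_on M \<pi>\<^sub>e B \<pi> \<le>
    (\<integral>\<^sup>+ s\<in>B. disc_state_dist M \<pi>\<^sub>e s * gfun_inner (actions M) (\<pi> s) (\<pi>\<^sub>e s) \<partial>states M)"
    by (rule objective_on_le[OF assms(2,4)])
  also have "\<dots> \<le> objective_on M \<pi>\<^sub>e B \<pi>\<^sub>e"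
    unfolding objective_on_self[OF assms(1,2)]
    by (intro nn_integral_mono mult_right_mono mult_left_mono
        gfun_inner_le_concentrated[OF mdp_actions[OF assms(1)] _ _ b]
        policy_action_dist[OF assms(2)] policy_action_dist[OF assms(4)]) auto
  finally show ?thesis .
qed

text \<open>
  In a continuous action space the location \<open>b s\<close> of the Dirac function \<open>\<pi>\<^sub>e s\<close> depends measurably on
  \<open>s\<close>, since \<open>b s \<in> E\<close> iff the measure \<open>\<pi>\<^sub>e s\<close> gives \<open>E\<close> the mass \<open>1\<close>.
\<close>

lemma measurable_inner_expert:
  assumes "is_mdp M" "policy M \<pi>\<^sub>e" "deterministic M \<pi>\<^sub>e" "policy M \<pi>"
  shows "(\<lambda>s. gfun_inner (actions M) (\<pi> s) (\<pi>\<^sub>e s)) \<in> borel_measurable (states M)"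
proof -
  note N = mdp_actions[OF assms(1)]
  note ad = policy_action_dist[OF assms(2)] policy_action_dist[OF assms(4)]
  obtain b where b: "\<And>s. s \<in> space (states M) \<Longrightarrow> concentrated (actions M) (b s) (\<pi>\<^sub>e s)"
    using deterministic_concentrated[OF assms(3)] by blast
  have [measurable]:
    "(\<lambda>(s, a). gfun_value (\<pi>\<^sub>e s) a) \<in> borel_measurable (states M \<Otimes>\<^sub>M actions M)"
    "(\<lambda>(s, a). gfun_value (\<pi> s) a) \<in> borel_measurable (states M \<Otimes>\<^sub>M actions M)"
    using assms(2,4) by (auto simp: policy_def)
  show ?thesis
    using N
  proof
    assume D: "discrete_space (actions M)"
    interpret A: sigma_finite_measure "actions M"
      by (rule sigma_finite_space[OF N])
    \<comment> \<open>In the discrete case both policies are ordinary functions, so the inner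
      product is a parametrized integral of the jointly measurable pointwise values.\<close>
    have "(\<lambda>s. \<integral>\<^sup>+ a. gfun_value (\<pi> s) a * gfun_value (\<pi>\<^sub>e s) a \<partial>actions M)
        \<in> borel_measurable (states M)"
      by measurable
    moreover have "gfun_inner (actions M) (\<pi> s) (\<pi>\<^sub>e s)
        = (\<integral>\<^sup>+ a. gfun_value (\<pi> s) a * gfun_value (\<pi>\<^sub>e s) a \<partial>actions M)"
      if "s \<in> space (states M)" for s
      using discrete_action_dist_cases[OF D ad(1)[OF that]]
        discrete_action_dist_cases[OF D ad(2)[OF that]]
      by (metis (no_types, lifting) gfun_inner.simps(1) gfun_value.simps(1) nn_integral_cong)
    ultimately show ?thesis
      by (simp cong: measurable_cong)
  next
    assume C: "continuous_space (actions M)"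
    have dirac: "\<pi>\<^sub>e s = Dirac 1 (b s)" if "s \<in> space (states M)" for s
      using continuous_concentrated_cases[OF C ad(1)[OF that] b[OF that]] .
    have [measurable]: "b \<in> states M \<rightarrow>\<^sub>M actions M"
    proof (rule measurableI)
      fix E assume E: "E \<in> sets (actions M)"
      have "(\<lambda>s. emeasure (gfun_measure (actions M) (\<pi>\<^sub>e s)) E) \<in> borel_measurable (states M)"
        by (rule measurable_compose[OF measurable_gfun_measure[OF assms(2)]
              measurable_emeasure_subprob_algebra[OF E]])
      then have "{s \<in> space (states M). emeasure (gfun_measure (actions M) (\<pi>\<^sub>e s)) E = 1}
          \<in> sets (states M)"
        by measurable
      also have "{s \<in> space (states M). emeasure (gfun_measure (actions M) (\<pi>\<^sub>e s)) E = 1}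
          = b -` E \<inter> space (states M)"
        using E by (auto simp: dirac indicator_def split: if_splits)
      finally show "b -` E \<inter> space (states M) \<in> sets (states M)" .
    qed (use b in \<open>auto simp: concentrated_def\<close>)
    \<comment> \<open>Joint measurability of the values is composed with the measurable map
      \<open>s \<mapsto> (s, b s)\<close>.\<close>
    have "(\<lambda>s. gfun_value (\<pi> s) (b s)) \<in> borel_measurable (states M)"
      by measurable
    moreover have "gfun_inner (actions M) (\<pi> s) (\<pi>\<^sub>e s) = gfun_value (\<pi> s) (b s)"
      if "s \<in> space (states M)" for s
      using gfun_inner_concentrated[OF N ad(2)[OF that] ad(1)[OF that] b[OF that]] .
    ultimately show ?thesis
      by (simp cong: measurable_cong)
  qed
qed

section \<open>Uniqueness of maximizers from equality of inner products\<close>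

lemma same_policyI:
  assumes "is_mdp M" "policy M \<pi>\<^sub>e" "deterministic M \<pi>\<^sub>e" "policy M \<pi>"
    and "AE s in states M. disc_state_dist M \<pi>\<^sub>e s > 0 \<longrightarrow>
      gfun_inner (actions M) (\<pi> s) (\<pi>\<^sub>e s) = gfun_inner (actions M) (\<pi>\<^sub>e s) (\<pi>\<^sub>e s)"
  shows "same_policy M \<pi>\<^sub>e \<pi>"
proof -
  obtain b where b: "\<And>s. s \<in> space (states M) \<Longrightarrow> concentrated (actions M) (b s) (\<pi>\<^sub>e s)"
    using deterministic_concentrated[OF assms(3)] by blast
  show ?thesis
    unfolding same_policy_def using assms(5) AE_space
  proof eventually_elim
    case (elim s)
    then show ?case
      using gfun_measure_eq_of_inner_eq[OF mdp_actions[OF assms(1)] policy_action_dist[OF assms(4)]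
          policy_action_dist[OF assms(2)] b] by blast
  qed
qed

text \<open>Optimality makes the integrals of \<open>?\<rho> s * ?i s\<close> and
  \<open>?\<rho> s\<close> equal and finite. Since the first integrand never exceeds the second,
  their nonnegative gap has integral 0 and vanishes almost everywhere.\<close>

lemma optimal_discrete_same_policy:
  assumes "is_mdp M" "policy M \<pi>\<^sub>e" "deterministic M \<pi>\<^sub>e"
    and D: "discrete_space (actions M)" and opt: "optimal M \<pi>\<^sub>e \<pi>"
  shows "same_policy M \<pi>\<^sub>e \<pi>"
proof -
  let ?\<rho> = "disc_state_dist M \<pi>\<^sub>e"
  let ?i = "\<lambda>s. gfun_inner (actions M) (\<pi> s) (\<pi>\<^sub>e s)"
  have \<pi>: "policy M \<pi>" and le: "objective M \<pi>\<^sub>e \<pi>\<^sub>e \<le> objective M \<pi>\<^sub>e \<pi>"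
    using opt assms(2) by (auto simp: optimal_def)
  obtain b where b: "\<And>s. s \<in> space (states M) \<Longrightarrow> concentrated (actions M) (b s) (\<pi>\<^sub>e s)"
    using deterministic_concentrated[OF assms(3)] by blast
  note ad = policy_action_dist[OF assms(2)] policy_action_dist[OF \<pi>]
  note [measurable] = measurable_disc_state_dist[OF assms(1,2)]
    measurable_inner_expert[OF assms(1-3) \<pi>]
  have self: "gfun_inner (actions M) (\<pi>\<^sub>e s) (\<pi>\<^sub>e s) = 1" if "s \<in> space (states M)" for s
    using gfun_inner_self_concentrated(1)[OF ad(1)[OF that] b[OF that] D] .
  have i_le: "?i s \<le> 1" if "s \<in> space (states M)" for s
    using gfun_inner_le_concentrated[OF disjI1[OF D] ad(2)[OF that] ad(1)[OF that] b[OF that]]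
    by (simp add: self that)
  have "(\<integral>\<^sup>+ s. ?\<rho> s \<partial>states M) = objective M \<pi>\<^sub>e \<pi>\<^sub>e"
    unfolding objective_eq_objective_on objective_on_self[OF assms(1,2)]
    by (intro nn_integral_cong) (simp add: self)
  also have "\<dots> \<le> objective M \<pi>\<^sub>e \<pi>" by (fact le)
  also have "\<dots> \<le> (\<integral>\<^sup>+ s\<in>space (states M). ?\<rho> s * ?i s \<partial>states M)"
    unfolding objective_eq_objective_on by (rule objective_on_le[OF assms(2) \<pi>])
  also have "\<dots> = (\<integral>\<^sup>+ s. ?\<rho> s * ?i s \<partial>states M)"
    by (intro nn_integral_cong) simp
  finally have ge: "(\<integral>\<^sup>+ s. ?\<rho> s \<partial>states M) \<le> (\<integral>\<^sup>+ s. ?\<rho> s * ?i s \<partial>states M)" .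
  have pointwise: "AE s in states M. ?\<rho> s * ?i s \<le> ?\<rho> s"
    using i_le by (intro AE_I2) (metis mult.right_neutral mult_left_mono zero_le)
  have le': "(\<integral>\<^sup>+ s. ?\<rho> s * ?i s \<partial>states M) \<le> (\<integral>\<^sup>+ s. ?\<rho> s \<partial>states M)"
    by (rule nn_integral_mono_AE[OF pointwise])
  have "(\<integral>\<^sup>+ s. ?\<rho> s - ?\<rho> s * ?i s \<partial>states M)
      = (\<integral>\<^sup>+ s. ?\<rho> s \<partial>states M) - (\<integral>\<^sup>+ s. ?\<rho> s * ?i s \<partial>states M)"
    using le' nn_integral_disc_state_dist[OF assms(1,2)]
    by (intro nn_integral_diff pointwise) (auto simp: top_unique)
  also have "\<dots> = 0"
    using ge by (simp add: diff_eq_0_iff_ennreal nn_integral_disc_state_dist[OF assms(1,2)])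
  finally have "AE s in states M. ?\<rho> s - ?\<rho> s * ?i s = 0"
    by (subst (asm) nn_integral_0_iff_AE) auto
  then have "AE s in states M. ?\<rho> s > 0 \<longrightarrow> ?i s = gfun_inner (actions M) (\<pi>\<^sub>e s) (\<pi>\<^sub>e s)"
    using AE_disc_state_dist_finite[OF assms(1,2)] AE_space
  proof eventually_elim
    case (elim s)
    have "1 \<le> ?i s" if pos: "?\<rho> s > 0"
    proof -
      \<comment> \<open>The factor \<open>?\<rho> s\<close> can be cancelled because it is positive
        and finite.\<close>
      have "?\<rho> s * 1 \<le> ?\<rho> s * ?i s"
        using elim(1,2) by (simp add: diff_eq_0_iff_ennreal)
      then show ?thesis
        using pos elim(2) by (subst (asm) ennreal_mult_le_mult_iff) auto
    qed
    then show ?case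
      using i_le[OF elim(3)] self[OF elim(3)] by auto
  qed
  then show ?thesis
    by (rule same_policyI[OF assms(1-3) \<pi>])
qed

lemma locally_optimal_continuous_same_policy:
  assumes "is_mdp M" "policy M \<pi>\<^sub>e" "deterministic M \<pi>\<^sub>e"
    and C: "continuous_space (actions M)" and opt: "locally_optimal M \<pi>\<^sub>e \<pi>"
  shows "same_policy M \<pi>\<^sub>e \<pi>"
proof -
  let ?\<rho> = "disc_state_dist M \<pi>\<^sub>e"
  let ?i = "\<lambda>s. gfun_inner (actions M) (\<pi> s) (\<pi>\<^sub>e s)"
  have \<pi>: "policy M \<pi>" using opt by (simp add: locally_optimal_def)
  obtain b where b: "\<And>s. s \<in> space (states M) \<Longrightarrow> concentrated (actions M) (b s) (\<pi>\<^sub>e s)"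
    using deterministic_concentrated[OF assms(3)] by blast
  note [measurable] = measurable_disc_state_dist[OF assms(1,2)]
    measurable_inner_expert[OF assms(1-3) \<pi>]
  have self: "gfun_inner (actions M) (\<pi>\<^sub>e s) (\<pi>\<^sub>e s) = \<infinity>" if "s \<in> space (states M)" for s
    using gfun_inner_self_concentrated(2)[OF policy_action_dist[OF assms(2) that] b[OF that] C] .
  have "AE s in states M. ?\<rho> s > 0 \<longrightarrow> \<not> ?i s \<le> of_nat n" for n :: nat
  proof -
    \<comment> \<open>This sublevel set is measurable, hence admissible in
      \<open>locally_optimal\<close>, because the inner product is measurable in the state.\<close>
    define B where "B = {s \<in> space (states M). ?i s \<le> of_nat n}"
    have B [measurable]: "B \<in> sets (states M)" unfolding B_def by measurable
    have "(\<integral>\<^sup>+ s. ?\<rho> s * \<infinity> * indicator B s \<partial>states M) = objective_on M \<pi>\<^sub>e B \<pi>\<^sub>e"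
      unfolding objective_on_self[OF assms(1,2)] by (intro nn_integral_cong) (simp add: self)
    also have "\<dots> \<le> objective_on M \<pi>\<^sub>e B \<pi>"
      using opt B assms(2) by (auto simp: locally_optimal_def)
    also have "\<dots> \<le> (\<integral>\<^sup>+ s\<in>B. ?\<rho> s * ?i s \<partial>states M)"
      by (rule objective_on_le[OF assms(2) \<pi>])
    also have "\<dots> \<le> (\<integral>\<^sup>+ s. ?\<rho> s * of_nat n \<partial>states M)"
      by (intro nn_integral_mono) (auto simp: B_def indicator_def intro: mult_left_mono)
    also have "\<dots> = ennreal (1 / (1 - disc M)) * of_nat n"
      by (simp add: nn_integral_multc nn_integral_disc_state_dist[OF assms(1,2)])
    also have "\<dots> < \<infinity>"
      by (simp add: ennreal_mult_less_top of_nat_less_top)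
    \<comment> \<open>A finite integral forces a finite integrand almost everywhere, and on
      \<open>B\<close> this means \<open>?\<rho> s = 0\<close>.\<close>
    finally have "AE s in states M. ?\<rho> s * \<infinity> * indicator B s \<noteq> \<infinity>"
      by (intro nn_integral_PInf_AE) auto
    then show ?thesis
      using AE_space by eventually_elim (auto simp: B_def ennreal_mult_top split: if_splits)
  qed
  \<comment> \<open>Countably many exceptional null sets are merged; a value exceeding every natural
    number is then \<infinity>.\<close>
  then have "AE s in states M. \<forall>n::nat. ?\<rho> s > 0 \<longrightarrow> \<not> ?i s \<le> of_nat n"
    by (simp only: AE_all_countable) blast
  then have "AE s in states M. ?\<rho> s > 0 \<longrightarrow> ?i s = gfun_inner (actions M) (\<pi>\<^sub>e s) (\<pi>\<^sub>e s)"
    using AE_space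
  proof eventually_elim
    case (elim s)
    have "?i s = \<infinity>" if "?\<rho> s > 0"
      using elim(1) that ennreal_Ex_less_of_nat[of "?i s"]
      by (metis infinity_ennreal_def less_imp_le less_top)
    then show ?case
      using self[OF elim(2)] by simp
  qed
  then show ?thesis
    by (rule same_policyI[OF assms(1-3) \<pi>])
qed

theorem theorem2:
  fixes M :: "('s, 'a) mdp" and \<pi>\<^sub>e :: "'s \<Rightarrow> 'a gfun"
  assumes "is_mdp M"
    and "policy M \<pi>\<^sub>e"
    and "deterministic M \<pi>\<^sub>e"
  shows "(\<forall>\<pi>. policy M \<pi> \<longrightarrow> (\<forall>s\<in>space (states M).
            gfun_inner (actions M) (\<pi> s) (\<pi> s) \<le> gfun_inner (actions M) (\<pi>\<^sub>e s) (\<pi>\<^sub>e s)))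
       \<and> optimal M \<pi>\<^sub>e \<pi>\<^sub>e
       \<and> locally_optimal M \<pi>\<^sub>e \<pi>\<^sub>e
       \<and> (discrete_space (actions M) \<longrightarrow>
            (\<forall>\<pi>'. optimal M \<pi>\<^sub>e \<pi>' \<longrightarrow> same_policy M \<pi>\<^sub>e \<pi>'))
       \<and> (continuous_space (actions M) \<longrightarrow>
            (\<forall>\<pi>'. locally_optimal M \<pi>\<^sub>e \<pi>' \<longrightarrow> same_policy M \<pi>\<^sub>e \<pi>'))"
proof (intro conjI allI impI ballI)
  obtain b where b: "\<And>s. s \<in> space (states M) \<Longrightarrow> concentrated (actions M) (b s) (\<pi>\<^sub>e s)"
    using deterministic_concentrated[OF assms(3)] by blast
  fix \<pi> s assume "policy M \<pi>" and s: "s \<in> space (states M)"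
  then show "gfun_inner (actions M) (\<pi> s) (\<pi> s) \<le> gfun_inner (actions M) (\<pi>\<^sub>e s) (\<pi>\<^sub>e s)"
    by (intro gfun_inner_self_le_concentrated[OF mdp_actions[OF assms(1)] _ _ b[OF s]]
        policy_action_dist assms(2))
next
  \<comment> \<open>The set of states is the whole space here and an arbitrary measurable set in the
    local version.\<close>
  show "optimal M \<pi>\<^sub>e \<pi>\<^sub>e"
    using assms objective_on_expert_max[OF assms]
    by (simp add: optimal_def objective_eq_objective_on)
  show "locally_optimal M \<pi>\<^sub>e \<pi>\<^sub>e"
    using assms objective_on_expert_max[OF assms] by (simp add: locally_optimal_def)
qed (use optimal_discrete_same_policy[OF assms]
       locally_optimal_continuous_same_policy[OF assms] in blast)+

end
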